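(* Let $\mathcal F=\bigwedge_{i=1}^{m}\bigvee_{j=1}^{j_i}\ell_{i,j}$ be a positive $k$-CNF formula over variables $X_1,\dots,X_n$ (each literal $\ell_{i,j}$ is some variable $X_u$, and $j_i\le k$). Consider: (L) the linear system $\sum_{j\le j_i}\ell_{i,j}=1$, $1\le i\le m$; (Q) the quadratic system consisting of the equations $$\Big(\sum_{j\le j_i}\ell_{i,j}\Big)\cdot\Big(\sum_{j\le j_t}\ell_{t,j}\Big)=1,\quad 1\le i\le t\le m,$$ $$X_u\cdot\sum_{j\le j_i}\ell_{i,j}=X_u^2,\quad 1\le u\le n,\ 1\le i\le m;$$ (R) the linear system $ReL(Z)$ obtained from (Q) by expanding the products and replacing each quadratic monomial $X_iX_j$ (with $X_iX_j$ and $X_jX_i$ identified, $i\le j$) by a new unknown $Z_{ij}$. Then the following are equivalent: (1) (L) has a Boolean solution; (2) (Q) has a Boolean solution; (3) $ReL(Z)$ has a Boolean solution.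
   Context: A Boolean solution of a system of equations is a solution in which every unknown takes a value in $\{0,1\}$. In the systems above, each literal $\ell_{i,j}=X_u$ is read as the real unknown $X_u$. *)

theory Defs
  imports Complex_Main "HOL-Library.Poly_Mapping"
begin

text \<open>
  A multivariate real polynomial with unknowns of type \<open>'v\<close> is a finitely supported map from
  power products (finitely supported exponent functions) to coefficients.  The product of
  HOL-Library.Poly_Mapping is convolution, so polynomials are always in expanded form, with
  \<open>X\<^sub>i X\<^sub>j\<close> and \<open>X\<^sub>j X\<^sub>i\<close> identified.
\<close>

type_synonym 'v mpoly = "('v \<Rightarrow>\<^sub>0 nat) \<Rightarrow>\<^sub>0 real"

definition Unk :: "'v \<Rightarrow> 'v mpoly" where
  "Unk v = Poly_Mapping.single (Poly_Mapping.single v 1) 1"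

definition eval_poly :: "('v \<Rightarrow> real) \<Rightarrow> 'v mpoly \<Rightarrow> real" where
  "eval_poly f p = (\<Sum>a\<in>Poly_Mapping.keys p.
     Poly_Mapping.lookup p a * (\<Prod>v\<in>Poly_Mapping.keys a. f v ^ Poly_Mapping.lookup a v))"

text \<open>A system is a set of equations \<open>p = q\<close>, each represented by the pair \<open>(p, q)\<close>.\<close>

type_synonym 'v system = "('v mpoly \<times> 'v mpoly) set"

definition is_solution :: "'v system \<Rightarrow> ('v \<Rightarrow> real) \<Rightarrow> bool" where
  "is_solution S f \<longleftrightarrow> (\<forall>(p, q)\<in>S. eval_poly f p = eval_poly f q)"

text \<open>\<open>V\<close> is the set of unknowns of the system; values of \<open>f\<close> outside \<open>V\<close> are irrelevant.\<close>

definition has_boolean_solution :: "'v set \<Rightarrow> 'v system \<Rightarrow> bool" where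
  "has_boolean_solution V S \<longleftrightarrow> (\<exists>f. (\<forall>v\<in>V. f v \<in> {0, 1}) \<and> is_solution S f)"

text \<open>
  All literals of a positive formula are variables, so a clause is the list of the indices of its
  literals and a formula is the list of its clauses.  A variable may be repeated in a clause, and
  a clause may be repeated in a formula.
\<close>

type_synonym clause = "nat list"

definition positive_kCNF :: "nat \<Rightarrow> nat \<Rightarrow> clause list \<Rightarrow> bool" where
  "positive_kCNF k n F \<longleftrightarrow> (\<forall>C\<in>set F. length C \<le> k \<and> set C \<subseteq> {1..n})"

definition clause_sum :: "clause \<Rightarrow> nat mpoly" where
  "clause_sum C = (\<Sum>j<length C. Unk (C ! j))"

definition lin_system :: "clause list \<Rightarrow> nat system" where
  "lin_system F = {(clause_sum (F ! i), 1) | i. i < length F}"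

definition quad_system :: "nat \<Rightarrow> clause list \<Rightarrow> nat system" where
  "quad_system n F =
     {(clause_sum (F ! i) * clause_sum (F ! t), 1) | i t. i \<le> t \<and> t < length F} \<union>
     {(Unk u * clause_sum (F ! i), (Unk u)\<^sup>2) | u i. u \<in> {1..n} \<and> i < length F}"

text \<open>
  Replacement of \<open>X\<^sub>i X\<^sub>j\<close>, \<open>i \<le> j\<close>, by the new unknown \<open>Z\<^sub>i\<^sub>j\<close>, which is indexed by \<open>(i, j)\<close>.  The
  power product \<open>0\<close> is that of constant terms, which are left alone.  Other power products do not
  occur in \<^const>\<open>quad_system\<close>, and for them the value below is meaningless.
\<close>

definition relin_monom :: "(nat \<Rightarrow>\<^sub>0 nat) \<Rightarrow> (nat \<times> nat \<Rightarrow>\<^sub>0 nat)" where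
  "relin_monom a = (if a = 0 then 0 else
     Poly_Mapping.single
       (THE ij. fst ij \<le> snd ij \<and>
          a = Poly_Mapping.single (fst ij) 1 + Poly_Mapping.single (snd ij) 1) 1)"

definition relin :: "nat mpoly \<Rightarrow> (nat \<times> nat) mpoly" where
  "relin p = (\<Sum>a\<in>Poly_Mapping.keys p.
     Poly_Mapping.single (relin_monom a) (Poly_Mapping.lookup p a))"

definition ReL :: "nat system \<Rightarrow> (nat \<times> nat) system" where
  "ReL S = (\<lambda>(p, q). (relin p, relin q)) ` S"

definition X_unknowns :: "nat \<Rightarrow> nat set" where
  "X_unknowns n = {1..n}"

definition Z_unknowns :: "nat \<Rightarrow> (nat \<times> nat) set" where
  "Z_unknowns n = {(i, j). 1 \<le> i \<and> i \<le> j \<and> j \<le> n}"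

lemma relin_monom_0 [simp]: "relin_monom 0 = 0"
  by (simp add: relin_monom_def)

lemma single_add_single_eqD:
  fixes i j i' j' :: nat
  assumes "i \<le> j" "i' \<le> j'"
    and eq: "Poly_Mapping.single i (1::nat) + Poly_Mapping.single j 1 =
             Poly_Mapping.single i' 1 + Poly_Mapping.single j' 1"
  shows "i = i' \<and> j = j'"
proof -
  have keys: "Poly_Mapping.keys (Poly_Mapping.single a (1::nat) + Poly_Mapping.single b 1) = {a, b}"
    for a b :: nat
    by (auto simp: in_keys_iff lookup_add lookup_single when_def split: if_splits)
  have "{i, j} = {i', j'}"
    using arg_cong[OF eq, of Poly_Mapping.keys] by (simp only: keys)
  with assms(1,2) show ?thesis by (auto simp: doubleton_eq_iff)
qed

lemma relin_monom_quadratic: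
  assumes "i \<le> j"
  shows "relin_monom (Poly_Mapping.single i 1 + Poly_Mapping.single j 1) =
         Poly_Mapping.single (i, j) 1"
proof -
  let ?a = "Poly_Mapping.single i (1::nat) + Poly_Mapping.single j 1"
  have "Poly_Mapping.lookup ?a i \<noteq> 0"
    by (simp add: lookup_add)
  then have "?a \<noteq> 0" by (metis lookup_zero)
  moreover have "(THE ij. fst ij \<le> snd ij \<and>
      ?a = Poly_Mapping.single (fst ij) 1 + Poly_Mapping.single (snd ij) 1) = (i, j)"
  proof (rule the_equality)
    show "fst (i, j) \<le> snd (i, j) \<and>
      ?a = Poly_Mapping.single (fst (i, j)) 1 + Poly_Mapping.single (snd (i, j)) 1"
      using assms by simp
    show "ij = (i, j)" if "fst ij \<le> snd ij \<and>
      ?a = Poly_Mapping.single (fst ij) 1 + Poly_Mapping.single (snd ij) 1" for ij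
      using single_add_single_eqD[OF assms, of "fst ij" "snd ij"] that
      by (cases ij) simp
  qed
  ultimately show ?thesis by (simp add: relin_monom_def)
qed

end

(*
  A Boolean solution of (Q) makes every clause sum a nonnegative number of square 1, hence equal
  to 1.  Conversely, from a Boolean solution Z of ReL(Z) put X_u = Z_uu: for a clause C the
  relinearized equations of the second kind give
    sum_{a in C} X_a = sum_{a in C} Z_aa = sum_{a in C} sum_{b in C} Z_ab,
  which is 1 by the relinearized equation of the first kind with i = t = C.  So X solves (L)
  although Z_ij = X_i X_j may fail.
*)
theory Submission imports Defs begin

section \<open>Linear functionals on polynomials, given by their values on power products\<close>

definition linear_ext :: "('a \<Rightarrow> real) \<Rightarrow> ('a \<Rightarrow>\<^sub>0 real) \<Rightarrow> real" where
  "linear_ext g p = (\<Sum>a\<in>Poly_Mapping.keys p. Poly_Mapping.lookup p a * g a)"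

text \<open>Power products outside the keys have coefficient 0. A larger index set is wanted for
  additivity, where \<open>p\<close>, \<open>q\<close> and \<open>p + q\<close> have different
  keys.\<close>

lemma linear_ext_superset:
  assumes "finite A" "Poly_Mapping.keys p \<subseteq> A"
  shows "linear_ext g p = (\<Sum>a\<in>A. Poly_Mapping.lookup p a * g a)"
  unfolding linear_ext_def
  by (rule sum.mono_neutral_left) (use assms in \<open>auto simp: in_keys_iff\<close>)

lemma linear_ext_zero [simp]: "linear_ext g 0 = 0"
  by (simp add: linear_ext_def)

lemma linear_ext_add: "linear_ext g (p + q) = linear_ext g p + linear_ext g q"
proof -
  let ?A = "Poly_Mapping.keys p \<union> Poly_Mapping.keys q"
  have "Poly_Mapping.keys (p + q) \<subseteq> ?A"
    by (rule Poly_Mapping.keys_add)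
  then show ?thesis
    by (simp add: linear_ext_superset[of ?A] lookup_add distrib_right sum.distrib)
qed

lemma linear_ext_sum: "linear_ext g (\<Sum>i\<in>I. p i) = (\<Sum>i\<in>I. linear_ext g (p i))"
  by (induction I rule: infinite_finite_induct) (simp_all add: linear_ext_add)

lemma linear_ext_single [simp]: "linear_ext g (Poly_Mapping.single a c) = c * g a"
  \<comment> \<open>The set of keys is empty if \<open>c = 0\<close>; the index set
    \<open>{a}\<close> covers both cases.\<close>
  by (subst linear_ext_superset[of "{a}"]) auto

lemma linear_ext_one [simp]:
  fixes g :: "('v \<Rightarrow>\<^sub>0 nat) \<Rightarrow> real"
  shows "linear_ext g 1 = g 0"
  by (simp flip: single_one)

section \<open>Evaluation of power products, before and after relinearization\<close>

definition eval_monom :: "('v \<Rightarrow> real) \<Rightarrow> ('v \<Rightarrow>\<^sub>0 nat) \<Rightarrow> real" where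
  "eval_monom f a = (\<Prod>v\<in>Poly_Mapping.keys a. f v ^ Poly_Mapping.lookup a v)"

lemma eval_poly_eq_linear_ext: "eval_poly f = linear_ext (eval_monom f)"
  by (simp add: fun_eq_iff eval_poly_def linear_ext_def eval_monom_def)

text \<open>\<open>relin p\<close> is a sum of single terms, so linearity applies term by term. The
  keys of \<open>relin p\<close>, and possible collisions under \<open>relin_monom\<close>, need not
  be examined.\<close>

lemma eval_poly_relin: "eval_poly z (relin p) = linear_ext (eval_monom z \<circ> relin_monom) p"
  by (simp add: eval_poly_eq_linear_ext relin_def linear_ext_sum) (simp add: linear_ext_def)

lemma eval_monom_zero [simp]: "eval_monom f 0 = 1"
  by (simp add: eval_monom_def)

lemma eval_monom_single [simp]: "eval_monom f (Poly_Mapping.single v 1) = f v"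
  by (simp add: eval_monom_def)

lemma eval_monom_quadratic:
  "eval_monom f (Poly_Mapping.single u 1 + Poly_Mapping.single v 1) = f u * f v"
proof -
  have "Poly_Mapping.keys (Poly_Mapping.single u (1::nat) + Poly_Mapping.single v 1) = {u, v}"
    by (auto simp: in_keys_iff lookup_add lookup_single when_def split: if_splits)
  then show ?thesis
    \<comment> \<open>If \<open>u = v\<close>, there is one key with exponent 2; otherwise there are
      two keys with exponent 1.\<close>
    by (cases "u = v") (auto simp: eval_monom_def lookup_add lookup_single power2_eq_square
        numeral_2_eq_2[symmetric])
qed

text \<open>Only ordered pairs index unknowns; as the power product is symmetric in \<open>i\<close>
  and \<open>j\<close>, \<open>min\<close> and \<open>max\<close> select the right one without a
  case distinction in later sums.\<close>

lemma eval_monom_relin_monom_quadratic: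
  "eval_monom z (relin_monom (Poly_Mapping.single i 1 + Poly_Mapping.single j 1)) =
   z (min i j, max i j)"
proof (cases "i \<le> j")
  case True
  then show ?thesis
    using relin_monom_quadratic[OF True] by (simp add: min_absorb1 max_absorb2 del: One_nat_def)
next
  case False
  then have "j \<le> i" by simp
  then show ?thesis
    using relin_monom_quadratic[OF \<open>j \<le> i\<close>]
    by (simp add: add.commute min_absorb2 max_absorb1 del: One_nat_def)
qed

section \<open>Expansion of the products in the quadratic system\<close>

lemma Unk_mult_Unk:
  "Unk u * Unk v = Poly_Mapping.single (Poly_Mapping.single u 1 + Poly_Mapping.single v 1) 1"
  by (simp add: Unk_def mult_single)

lemma clause_sum_eq_sum_list: "clause_sum C = (\<Sum>v\<leftarrow>C. Unk v)"
  by (simp add: clause_sum_def sum_list_sum_nth atLeast0LessThan)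

lemma linear_ext_sum_list: "linear_ext g (\<Sum>v\<leftarrow>xs. p v) = (\<Sum>v\<leftarrow>xs. linear_ext g (p v))"
  by (induction xs) (simp_all add: linear_ext_add)

text \<open>Here and in the next lemma \<open>g\<close> stays arbitrary: \<open>eval_monom x\<close>
  gives evaluation, and \<open>eval_monom z \<circ> relin_monom\<close> gives evaluation after
  relinearization, so one expansion serves both.\<close>

lemma linear_ext_Unk_mult_clause_sum:
  "linear_ext g (Unk u * clause_sum C) =
   (\<Sum>v\<leftarrow>C. g (Poly_Mapping.single u 1 + Poly_Mapping.single v 1))"
  by (simp add: clause_sum_eq_sum_list linear_ext_sum_list Unk_mult_Unk del: One_nat_def
      flip: sum_list_const_mult)

lemma linear_ext_clause_sum_mult:
  "linear_ext g (clause_sum C * clause_sum D) =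
   (\<Sum>u\<leftarrow>C. \<Sum>v\<leftarrow>D. g (Poly_Mapping.single u 1 + Poly_Mapping.single v 1))"
proof -
  \<comment> \<open>Expanding the first factor alone leaves products of the form just
    treated.\<close>
  have "clause_sum C * clause_sum D = (\<Sum>u\<leftarrow>C. Unk u * clause_sum D)"
    unfolding clause_sum_eq_sum_list[of C] by (rule sum_list_mult_const[symmetric])
  then show ?thesis
    by (simp add: linear_ext_sum_list linear_ext_Unk_mult_clause_sum)
qed

section \<open>The three systems as equations between real numbers\<close>

lemma is_solution_family:
  "is_solution {(p i, q i) | i. P i} f \<longleftrightarrow> (\<forall>i. P i \<longrightarrow> eval_poly f (p i) = eval_poly f (q i))"
  unfolding is_solution_def by blast

lemma is_solution_family2:
  "is_solution {(p i j, q i j) | i j. P i j} f \<longleftrightarrow>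
   (\<forall>i j. P i j \<longrightarrow> eval_poly f (p i j) = eval_poly f (q i j))"
  unfolding is_solution_def by blast

lemma is_solution_Un: "is_solution (S \<union> T) f \<longleftrightarrow> is_solution S f \<and> is_solution T f"
  by (simp add: is_solution_def ball_Un)

lemma is_solution_ReL:
  "is_solution (ReL S) f \<longleftrightarrow> (\<forall>(p, q)\<in>S. eval_poly f (relin p) = eval_poly f (relin q))"
  by (simp add: is_solution_def ReL_def case_prod_beta)

lemma is_solution_ReL_quad_system_relin:
  "is_solution (ReL (quad_system n F)) f \<longleftrightarrow>
   (\<forall>i t. i \<le> t \<and> t < length F \<longrightarrow>
     eval_poly f (relin (clause_sum (F ! i) * clause_sum (F ! t))) = eval_poly f (relin 1)) \<and>
   (\<forall>u i. u \<in> {1..n} \<and> i < length F \<longrightarrow>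
     eval_poly f (relin (Unk u * clause_sum (F ! i))) = eval_poly f (relin ((Unk u)\<^sup>2)))"
  unfolding is_solution_ReL quad_system_def ball_Un by blast

lemma is_solution_lin_system:
  "is_solution (lin_system F) x \<longleftrightarrow> (\<forall>C\<in>set F. (\<Sum>u\<leftarrow>C. x u) = 1)"
proof -
  have "eval_poly x (clause_sum C) = (\<Sum>u\<leftarrow>C. x u)" for C
    by (simp add: eval_poly_eq_linear_ext clause_sum_eq_sum_list linear_ext_sum_list Unk_def
        del: One_nat_def)
  moreover have "eval_poly x 1 = 1"
    by (simp add: eval_poly_eq_linear_ext)
  ultimately show ?thesis
    by (simp add: lin_system_def is_solution_family all_set_conv_all_nth)
qed

lemma is_solution_quad_system:
  "is_solution (quad_system n F) x \<longleftrightarrow>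
   (\<forall>i t. i \<le> t \<and> t < length F \<longrightarrow> (\<Sum>u\<leftarrow>F ! i. x u) * (\<Sum>v\<leftarrow>F ! t. x v) = 1) \<and>
   (\<forall>u\<in>{1..n}. \<forall>i<length F. x u * (\<Sum>v\<leftarrow>F ! i. x v) = (x u)\<^sup>2)"
proof -
  have "eval_poly x (clause_sum C * clause_sum D) = (\<Sum>u\<leftarrow>C. x u) * (\<Sum>v\<leftarrow>D. x v)" for C D
    by (simp add: eval_poly_eq_linear_ext linear_ext_clause_sum_mult eval_monom_quadratic
        sum_list_const_mult sum_list_mult_const del: One_nat_def)
  moreover have "eval_poly x (Unk u * clause_sum C) = x u * (\<Sum>v\<leftarrow>C. x v)" for u C
    by (simp add: eval_poly_eq_linear_ext linear_ext_Unk_mult_clause_sum eval_monom_quadratic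
        sum_list_const_mult del: One_nat_def)
  moreover have "eval_poly x ((Unk u)\<^sup>2) = (x u)\<^sup>2" for u
    by (simp add: eval_poly_eq_linear_ext power2_eq_square Unk_mult_Unk eval_monom_quadratic
        del: One_nat_def)
  moreover have "eval_poly x 1 = 1"
    by (simp add: eval_poly_eq_linear_ext)
  ultimately show ?thesis
    unfolding quad_system_def is_solution_Un is_solution_family2 by (simp add: Ball_def imp_conjL)
qed

text \<open>Unlike in the quadratic system, the double sum stays unfactored, because
  \<open>z\<close> need not consist of products of values of the \<open>X\<close> unknowns.\<close>

lemma is_solution_ReL_quad_system:
  "is_solution (ReL (quad_system n F)) z \<longleftrightarrow>
   (\<forall>i t. i \<le> t \<and> t < length F \<longrightarrow> (\<Sum>u\<leftarrow>F ! i. \<Sum>v\<leftarrow>F ! t. z (min u v, max u v)) = 1) \<and>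
   (\<forall>u\<in>{1..n}. \<forall>i<length F. (\<Sum>v\<leftarrow>F ! i. z (min u v, max u v)) = z (u, u))"
proof -
  have "eval_poly z (relin (clause_sum C * clause_sum D)) =
      (\<Sum>u\<leftarrow>C. \<Sum>v\<leftarrow>D. z (min u v, max u v))" for C D
    by (simp add: eval_poly_relin linear_ext_clause_sum_mult eval_monom_relin_monom_quadratic
        del: One_nat_def)
  moreover have "eval_poly z (relin (Unk u * clause_sum C)) =
      (\<Sum>v\<leftarrow>C. z (min u v, max u v))" for u C
    by (simp add: eval_poly_relin linear_ext_Unk_mult_clause_sum eval_monom_relin_monom_quadratic
        del: One_nat_def)
  moreover have "eval_poly z (relin ((Unk u)\<^sup>2)) = z (u, u)" for u
    by (simp add: eval_poly_relin power2_eq_square Unk_mult_Unk eval_monom_relin_monom_quadratic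
        del: One_nat_def)
  moreover have "eval_poly z (relin 1) = 1"
    by (simp add: eval_poly_relin)
  ultimately show ?thesis
    unfolding is_solution_ReL_quad_system_relin by (simp add: Ball_def imp_conjL)
qed

section \<open>Passing solutions from one system to another\<close>

lemma lin_imp_quad:
  assumes "\<forall>u\<in>{1..n}. x u \<in> {0, 1}" "is_solution (lin_system F) x"
  shows "is_solution (quad_system n F) x"
proof -
  have "(\<Sum>u\<leftarrow>F ! i. x u) = 1" if "i < length F" for i
    using assms(2) that by (simp add: is_solution_lin_system)
  moreover have "(x u)\<^sup>2 = x u" if "u \<in> {1..n}" for u
  proof -
    have "x u \<in> {0, 1}" using assms(1) that by blast
    then show ?thesis by auto
  qed
  \<comment> \<open>With all clause sums equal to 1, the first kind of equation reads 1 * 1 = 1 and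
    the second reads \<open>x u = (x u)\<^sup>2\<close>.\<close>
  ultimately show ?thesis
    by (simp add: is_solution_quad_system)
qed

lemma quad_imp_lin:
  assumes "positive_kCNF k n F" "\<forall>u\<in>{1..n}. x u \<in> {0, 1}" "is_solution (quad_system n F) x"
  shows "is_solution (lin_system F) x"
  unfolding is_solution_lin_system
proof
  fix C assume "C \<in> set F"
  then have "(\<Sum>u\<leftarrow>C. x u) * (\<Sum>u\<leftarrow>C. x u) = 1"
    using assms(3) by (auto simp: is_solution_quad_system in_set_conv_nth)
  \<comment> \<open>This excludes the root -1. Clause variables lie in \<open>{1..n}\<close>, where
    \<open>x\<close> is known to be Boolean.\<close>
  moreover have "0 \<le> (\<Sum>u\<leftarrow>C. x u)"
  proof (rule sum_list_nonneg)
    fix y assume "y \<in> set (map x C)"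
    then have "y \<in> {0, 1}"
      using assms(1,2) \<open>C \<in> set F\<close> unfolding positive_kCNF_def by fastforce
    then show "0 \<le> y" by auto
  qed
  ultimately show "(\<Sum>u\<leftarrow>C. x u) = 1"
    by (simp add: square_eq_1_iff)
qed

lemma quad_imp_ReL:
  assumes "is_solution (quad_system n F) x"
  shows "is_solution (ReL (quad_system n F)) (\<lambda>(u, v). x u * x v)"
proof -
  \<comment> \<open>Commutativity removes the ordering of indices, after which the double sums
    factor back into products of clause sums.\<close>
  have "x (min u v) * x (max u v) = x u * x v" for u v
    by (cases "u \<le> v") (simp_all add: min_def max_def mult.commute)
  then show ?thesis
    using assms
    by (simp add: is_solution_quad_system is_solution_ReL_quad_system sum_list_const_mult
        sum_list_mult_const power2_eq_square)
qed

lemma ReL_imp_lin: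
  assumes "positive_kCNF k n F" "is_solution (ReL (quad_system n F)) z"
  shows "is_solution (lin_system F) (\<lambda>u. z (u, u))"
  unfolding is_solution_lin_system
proof
  fix C assume C: "C \<in> set F"
  have "(\<Sum>v\<leftarrow>C. z (min u v, max u v)) = z (u, u)" if "u \<in> set C" for u
  proof -
    \<comment> \<open>Equations of the second kind are available only for these indices.\<close>
    have "u \<in> {1..n}"
      using assms(1) C that unfolding positive_kCNF_def by blast
    then show ?thesis
      using assms(2) C unfolding is_solution_ReL_quad_system in_set_conv_nth by blast
  qed
  \<comment> \<open>The second kind of equation, with \<open>C\<close> as its clause, is applied to
    each literal of \<open>C\<close>; sums over lists count repeated literals correctly.\<close>
  then have "(\<Sum>u\<leftarrow>C. z (u, u)) = (\<Sum>u\<leftarrow>C. \<Sum>v\<leftarrow>C. z (min u v, max u v))"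
    by (intro arg_cong[where f = sum_list] map_cong) simp_all
  also have "\<dots> = 1"
    using assms(2) C unfolding is_solution_ReL_quad_system in_set_conv_nth by blast
  finally show "(\<Sum>u\<leftarrow>C. z (u, u)) = 1" .
qed

theorem theorem1:
  fixes k n :: nat and F :: "clause list"
  assumes "positive_kCNF k n F"
  shows "(has_boolean_solution (X_unknowns n) (lin_system F) \<longleftrightarrow>
          has_boolean_solution (X_unknowns n) (quad_system n F)) \<and>
         (has_boolean_solution (X_unknowns n) (quad_system n F) \<longleftrightarrow>
          has_boolean_solution (Z_unknowns n) (ReL (quad_system n F)))"
proof -
  have "has_boolean_solution (X_unknowns n) (lin_system F) \<longleftrightarrow>
      has_boolean_solution (X_unknowns n) (quad_system n F)"
    unfolding has_boolean_solution_def X_unknowns_def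
    using lin_imp_quad quad_imp_lin[OF assms] by blast
  moreover have "has_boolean_solution (Z_unknowns n) (ReL (quad_system n F))"
    if quad: "has_boolean_solution (X_unknowns n) (quad_system n F)"
  proof -
    obtain x where x: "\<forall>u\<in>{1..n}. x u \<in> {0, 1}" and sol: "is_solution (quad_system n F) x"
      using quad unfolding has_boolean_solution_def X_unknowns_def by blast
    \<comment> \<open>A product of two values in {0, 1} is again in {0, 1}.\<close>
    have "(case w of (u, v) \<Rightarrow> x u * x v) \<in> {0, 1}" if "w \<in> Z_unknowns n" for w
    proof (cases w)
      case (Pair u v)
      then have "u \<in> {1..n}" "v \<in> {1..n}"
        using that by (auto simp: Z_unknowns_def)
      then have "x u \<in> {0, 1}" "x v \<in> {0, 1}"
        using x by blast+
      then show ?thesis by (auto simp: Pair)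
    qed
    with quad_imp_ReL[OF sol] show ?thesis
      unfolding has_boolean_solution_def
      by (intro exI[where x = "\<lambda>(u, v). x u * x v"] conjI ballI)
  qed
  \<comment> \<open>The way back from \<open>ReL\<close> leads to the linear system; the equivalence
    already shown then yields the quadratic one.\<close>
  moreover have "has_boolean_solution (X_unknowns n) (lin_system F)"
    if ReL: "has_boolean_solution (Z_unknowns n) (ReL (quad_system n F))"
  proof -
    obtain z where z: "\<forall>v\<in>Z_unknowns n. z v \<in> {0, 1}"
        and sol: "is_solution (ReL (quad_system n F)) z"
      using ReL unfolding has_boolean_solution_def by blast
    have "z (u, u) \<in> {0, 1}" if "u \<in> X_unknowns n" for u
    proof -
      have "(u, u) \<in> Z_unknowns n"
        using that by (simp add: X_unknowns_def Z_unknowns_def)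
      with z show ?thesis by blast
    qed
    with ReL_imp_lin[OF assms sol] show ?thesis
      unfolding has_boolean_solution_def
      by (intro exI[where x = "\<lambda>u. z (u, u)"] conjI ballI)
  qed
  ultimately show ?thesis by blast
qed

end
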